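(* As $n\to\infty$, the Knight graph $G_n$ of size $n$ satisfies $$\tfrac{7}{16}\,n^2-O(n)\ \le\ \alpha_{\mathrm{od}}(G_n)\ \le\ \tfrac{7}{15}\,n^2+O(n).$$
   Context: The Knight graph of size $n$ has vertex set $\{1,\dots,n\}\times\{1,\dots,n\}$; two vertices $(a,b),(a',b')$ are adjacent iff $\{|a-a'|,|b-b'|\}=\{1,2\}$. $N(v)$ is the open neighborhood of $v$. An odd independent set is an independent set $S$ of vertices such that every vertex $v\notin S$ has either $N(v)\cap S=\varnothing$ or $|N(v)\cap S|$ odd; $\alpha_{\mathrm{od}}(G)$ is the largest cardinality of an odd independent set in $G$. *)

theory Defs
  imports
    Complex_Main
    "HOL-Library.Landau_Symbols"
    "Graph_Theory.Pair_Digraph"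
begin

(* A finite simple graph is a pair_graph: a finite, loop-free, symmetric pair digraph,
   with one arc in each direction for every undirected edge. *)

definition neighborhood :: "'a pair_pre_digraph \<Rightarrow> 'a \<Rightarrow> 'a set" where
  "neighborhood G v = {w \<in> pverts G. (v, w) \<in> parcs G}"

definition independent_set :: "'a pair_pre_digraph \<Rightarrow> 'a set \<Rightarrow> bool" where
  "independent_set G S \<longleftrightarrow>
     S \<subseteq> pverts G \<and> (\<forall>u\<in>S. \<forall>v\<in>S. (u, v) \<notin> parcs G)"

definition odd_independent_set :: "'a pair_pre_digraph \<Rightarrow> 'a set \<Rightarrow> bool" where
  "odd_independent_set G S \<longleftrightarrow> independent_set G S \<and>
     (\<forall>v\<in>pverts G - S. neighborhood G v \<inter> S = {} \<or> odd (card (neighborhood G v \<inter> S)))"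

definition odd_independence_number :: "'a pair_pre_digraph \<Rightarrow> nat" where
  "odd_independence_number G = Max (card ` {S. odd_independent_set G S})"

(* Integer coordinates, so that the coordinate differences are not truncated. *)
definition knight_graph :: "nat \<Rightarrow> (int \<times> int) pair_pre_digraph" where
  "knight_graph n =
     (let V = {1..int n} \<times> {1..int n}
      in \<lparr>pverts = V,
          parcs = {((a, b), (a', b')) | a b a' b'.
             (a, b) \<in> V \<and> (a', b') \<in> V \<and> {\<bar>a - a'\<bar>, \<bar>b - b'\<bar>} = {1, 2}}\<rparr>)"

lemma pair_graph_knight_graph: "pair_graph (knight_graph n)"
proof
  show "finite (parcs (knight_graph n))"
    by (rule finite_subset[of _ "({1..int n} \<times> {1..int n}) \<times> ({1..int n} \<times> {1..int n})"])
       (auto simp: knight_graph_def Let_def)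
  show "symmetric (with_proj (knight_graph n))"
    unfolding symmetric_def with_proj_simps
    by (rule symI) (auto simp: knight_graph_def Let_def abs_minus_commute)
qed (auto simp: knight_graph_def Let_def doubleton_eq_iff)

(* The maximum in odd_independence_number is over a finite nonempty set. *)
lemma odd_independence_number_wf:
  assumes "pair_graph G"
  shows "finite {S. odd_independent_set G S}" "odd_independent_set G {}"
proof -
  interpret pair_graph G by fact
  show "finite {S. odd_independent_set G S}"
    by (rule finite_subset[of _ "Pow (pverts G)"])
       (auto simp: odd_independent_set_def independent_set_def pair_finite_verts)
qed (auto simp: odd_independent_set_def independent_set_def)

end

theory Submission
  imports Defs
begin

text \<open>
  Upper bound. A cell outside an odd independent set \<open>S\<close> has at most eight neighbours, and
  evenly many of them in \<open>S\<close> only if none is, hence at most seven in \<open>S\<close>. A cell of \<open>S\<close> at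
  distance at least two from the border has eight neighbours, none of them in \<open>S\<close>. Counting
  the edges between \<open>S\<close> and its complement from both sides gives
  \<open>8 (|S| - O(n)) \<le> 7 (n\<^sup>2 - |S|)\<close>.

  Lower bound. The eight knight moves change \<open>x - 7 y\<close> modulo 16 by the eight odd residues,
  each occurring once. So if \<open>S\<close> consists of the cells of one colour that avoid one residue
  class of \<open>x - 7 y\<close> modulo 16, then every cell of the other colour has exactly seven
  neighbours in \<open>S\<close>; this \<open>S\<close> has density \<open>7/16\<close>. On a finite board it must end near the
  border, and simply cutting it off creates cells with evenly many neighbours in \<open>S\<close>. The
  repair is a fixed finite set \<open>tile\<close> inside a 38 by 38 square, which satisfies the condition
  at every cell of the unbounded board (\<open>odd_at_tile\<close>, a finite computation). On its inner 20 by 20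
  square it is the periodic pattern; around that square it fades out through a sparse frame.
  Moreover the four rows 26 to 29 of \<open>tile\<close> repeat the rows 10 to 13, and likewise for the
  columns. The condition at a cell only concerns a 5 by 5 window, so further periods of 16 rows
  and 16 columns can be inserted without creating a new kind of window
  (\<open>odd_at_stretched_tile\<close>). Inserting \<open>k\<close> periods in each direction gives a set that fits into a
  square of side \<open>38 + 16 k\<close> and has at least \<open>112 k\<^sup>2 = 7/16 (16 k)\<^sup>2\<close> elements.
\<close>

section \<open>Knight moves on the infinite board\<close>

text \<open>The eight cells that a knight on \<open>v\<close> attacks on the unbounded board.\<close>

definition knight_nbrs :: "int \<times> int \<Rightarrow> (int \<times> int) set" where
  "knight_nbrs v = (case v of (x, y) \<Rightarrow>
     {(x + 1, y + 2), (x + 1, y - 2), (x - 1, y + 2), (x - 1, y - 2),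
      (x + 2, y + 1), (x + 2, y - 1), (x - 2, y + 1), (x - 2, y - 1)})"

lemma finite_knight_nbrs: "finite (knight_nbrs v)"
  by (cases v) (simp add: knight_nbrs_def)

lemma card_knight_nbrs: "card (knight_nbrs v) = 8"
  by (cases v) (simp add: knight_nbrs_def)

lemma knight_step_iff:
  fixes a b a' b' :: int
  shows "{\<bar>a - a'\<bar>, \<bar>b - b'\<bar>} = {1, 2} \<longleftrightarrow> (a', b') \<in> knight_nbrs (a, b)"
proof -
  have 1: "\<bar>c - c'\<bar> = 1 \<longleftrightarrow> c' = c + 1 \<or> c' = c - 1" for c c' :: int
    by arith
  have 2: "\<bar>c - c'\<bar> = 2 \<longleftrightarrow> c' = c + 2 \<or> c' = c - 2" for c c' :: int
    by arith
  show ?thesis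
    unfolding doubleton_eq_iff knight_nbrs_def 1 2 by auto
qed

lemma knight_nbrs_sym: "w \<in> knight_nbrs v \<longleftrightarrow> v \<in> knight_nbrs w"
  by (cases v; cases w) (simp add: knight_step_iff[symmetric] abs_minus_commute)

lemma pverts_knight_graph: "pverts (knight_graph n) = {1..int n} \<times> {1..int n}"
  by (simp add: knight_graph_def Let_def)

lemma parcs_knight_graph:
  "(v, w) \<in> parcs (knight_graph n) \<longleftrightarrow>
     v \<in> pverts (knight_graph n) \<and> w \<in> pverts (knight_graph n) \<and> w \<in> knight_nbrs v"
  by (cases v; cases w) (auto simp: knight_graph_def Let_def knight_step_iff)

lemma neighborhood_knight_graph:
  assumes "v \<in> pverts (knight_graph n)"
  shows "neighborhood (knight_graph n) v = knight_nbrs v \<inter> pverts (knight_graph n)"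
  using assms by (auto simp: neighborhood_def parcs_knight_graph)

text \<open>Independence at \<open>v\<close> and the parity condition at \<open>v\<close> in one statement, with
  neighbours taken on the unbounded board.\<close>

definition odd_at :: "(int \<times> int) set \<Rightarrow> int \<times> int \<Rightarrow> bool" where
  "odd_at S v \<longleftrightarrow>
     knight_nbrs v \<inter> S = {} \<or> v \<notin> S \<and> odd (card (knight_nbrs v \<inter> S))"

lemma odd_independent_set_knight_graphI:
  assumes sub: "S \<subseteq> pverts (knight_graph n)" and odd: "\<And>v. odd_at S v"
  shows "odd_independent_set (knight_graph n) S"
proof -
  have nb: "neighborhood (knight_graph n) v \<inter> S = knight_nbrs v \<inter> S"
    if "v \<in> pverts (knight_graph n)" for v
    using neighborhood_knight_graph[OF that] sub by auto
  have "(u, v) \<notin> parcs (knight_graph n)" if "u \<in> S" "v \<in> S" for u v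
    using odd[of u] that by (auto simp: parcs_knight_graph odd_at_def)
  moreover have "neighborhood (knight_graph n) v \<inter> S = {} \<or>
      odd (card (neighborhood (knight_graph n) v \<inter> S))"
    if "v \<in> pverts (knight_graph n) - S" for v
    using odd[of v] nb[of v] that by (auto simp: odd_at_def)
  ultimately show ?thesis
    using sub by (auto simp: odd_independent_set_def independent_set_def)
qed

lemma odd_at_iff:
  "odd_at S (x, y) \<longleftrightarrow>
    (let ps = map (\<lambda>v. v \<in> S)
       [(x + 1, y + 2), (x + 1, y - 2), (x - 1, y + 2), (x - 1, y - 2),
        (x + 2, y + 1), (x + 2, y - 1), (x - 2, y + 1), (x - 2, y - 1)]
     in True \<in> set ps \<longrightarrow> (x, y) \<notin> S \<and> foldr (\<noteq>) ps False)"
  (is "_ \<longleftrightarrow> (let ps = ?ps in _)")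
proof -
  have "card (knight_nbrs (x, y) \<inter> S) = (\<Sum>v\<in>knight_nbrs (x, y). of_bool (v \<in> S))"
    by (simp add: finite_knight_nbrs)
  \<comment> \<open>On truth values, \<open>\<noteq>\<close> is addition modulo 2.\<close>
  also have "odd \<dots> \<longleftrightarrow> foldr (\<noteq>) ?ps False"
    by (simp add: knight_nbrs_def del: sum_of_bool_eq)
  finally have 1: "odd (card (knight_nbrs (x, y) \<inter> S)) \<longleftrightarrow> foldr (\<noteq>) ?ps False" .
  have "?ps = map (\<lambda>v. v \<in> S) vs \<Longrightarrow> set vs = knight_nbrs (x, y) \<Longrightarrow>
      True \<in> set ?ps \<longleftrightarrow> knight_nbrs (x, y) \<inter> S \<noteq> {}" for vs
    by (auto simp del: list.map)
  from this[OF refl] have 2: "True \<in> set ?ps \<longleftrightarrow> knight_nbrs (x, y) \<inter> S \<noteq> {}"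
    by (simp only: knight_nbrs_def list.set case_prod_conv refl)
  show ?thesis
    unfolding odd_at_def Let_def 1 2 by blast
qed

lemma odd_at_cong:
  assumes "\<And>d e. \<bar>d\<bar> \<le> 2 \<Longrightarrow> \<bar>e\<bar> \<le> 2 \<Longrightarrow> (x + d, y + e) \<in> S \<longleftrightarrow> (x' + d, y' + e) \<in> S'"
  shows "odd_at S (x, y) \<longleftrightarrow> odd_at S' (x', y')"
proof -
  have c: "(x + d, y + e) \<in> S \<longleftrightarrow> (x' + d, y' + e) \<in> S'"
    if "d \<in> {-2, -1, 0, 1, 2}" "e \<in> {-2, -1, 0, 1, 2}" for d e
    using assms[of d e] that by auto
  show ?thesis
    using c[of 0 0] c[of 1 2] c[of 1 "-2"] c[of "-1" 2] c[of "-1" "-2"]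
      c[of 2 1] c[of 2 "-1"] c[of "-2" 1] c[of "-2" "-1"]
    by (simp add: odd_at_iff)
qed

section \<open>A finite odd independent pattern\<close>

text \<open>The rows of \<open>tile\<close>, one binary numeral per row. The least significant bit of a row is its
  cell in column 1, so the picture shows the columns 38 to 1 from left to right, and the rows 1
  to 38 from top to bottom. On the square \<open>{10..29} \<times> {10..29}\<close> the cells of \<open>tile\<close> are those with
  \<open>x + y\<close> odd and \<open>x - 7 y\<close> not congruent to 3 modulo 16. The frame around it is a solution,
  found by computer search, of the parity conditions that \<open>tile_row_check\<close> expresses.\<close>

definition tile_rows :: "int list" where
  "tile_rows =
   [0b00000000000000000000000000000010001000,
    0b00000000000000000000010000000000010000,
    0b00100000000000100000000000000000000000,
    0b00000000000000000000000100000001000000,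
    0b00000010000000001000000000000010001000,
    0b00010000000101010101010100010100000000,
    0b10000000101010101000101010101000000000,
    0b00000000010001010101010101000100000000,
    0b00001000101010101010001010101000000000,
    0b00000000010100010101010101010000000000,
    0b00000010101010101010100010101000000000,
    0b00000000010101000101010101010101000000,
    0b00000000001010101010101000101000000000,
    0b00000000010101010001010101010100010000,
    0b00000000100010101010101010001000000000,
    0b00000000010101010100010101010100000000,
    0b00000000101000101010101010100000000000,
    0b00000100010101010101000101010100000000,
    0b00000000101010001010101010101010000000,
    0b00000001010101010101010001010100000000,
    0b00000000101010100010101010101000100000,
    0b00000000000101010101010100010100000000,
    0b00000000101010101000101010101000000000,
    0b00000000010001010101010101000100000000,
    0b00001000101010101010001010101000000000,
    0b00000000010100010101010101010000000000,
    0b00000010101010101010100010101000000000,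
    0b00000000010101000101010101010101000000,
    0b00000000001010101010101000101000000000,
    0b00000000010101010001010101010100010000,
    0b00000000100010101010101010001000000000,
    0b00000000010101010100010101010100000001,
    0b00000000101000101010101010100000001000,
    0b00010001000000000000010000000001000000,
    0b00000010000000100000000000000000000000,
    0b00000000000000000000000100000000000100,
    0b00001000000000001000000000000000000000,
    0b00010001000000000000000000000000000000]"

text \<open>Row \<open>y\<close> of \<open>tile\<close> as a bit string; the rows outside \<open>{1..38}\<close> are empty.\<close>

definition tile_row :: "int \<Rightarrow> int" where
  "tile_row y = (if 1 \<le> y \<and> y \<le> 38 then tile_rows ! nat (y - 1) else 0)"

text \<open>The finite odd independent set of the unbounded board that the rows describe. Column \<open>x\<close> is
  bit \<open>x - 1\<close>; the guard \<open>1 \<le> x\<close> matters because \<open>nat\<close> maps negative integers to 0.\<close>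

definition tile :: "(int \<times> int) set" where
  "tile = {(x, y). 1 \<le> x \<and> bit (tile_row y) (nat (x - 1))}"

text \<open>The condition \<open>odd_at tile (x, y)\<close> for all \<open>x \<ge> -1\<close> at once. Each of the eight shifted rows
  tells at bit \<open>x + 1\<close> whether one of the neighbours of \<open>(x, y)\<close> is in \<open>tile\<close>. So the exclusive
  disjunction of these rows is the parity of the number of neighbours in \<open>tile\<close>, and their
  disjunction \<open>u\<close> tells whether there are any. Both have to agree, and \<open>u\<close> has to be disjoint from
  \<open>c\<close>, row \<open>y\<close> itself: no cell of \<open>tile\<close> may have a neighbour in \<open>tile\<close>.\<close>

definition tile_row_check :: "int \<Rightarrow> bool" where
  "tile_row_check y \<longleftrightarrow>
     (let a = tile_row (y - 2); b = tile_row (y - 1); c = push_bit 2 (tile_row y);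
          d = tile_row (y + 1); e = tile_row (y + 2);
          rs = [push_bit 1 e, push_bit 1 a, push_bit 3 e, push_bit 3 a,
                push_bit 0 d, push_bit 0 b, push_bit 4 d, push_bit 4 b];
          u = foldr or rs 0
      in foldr xor rs 0 = u \<and> and u c = 0)"

text \<open>The rows \<open>-1\<close> to \<open>40\<close> are those whose cells can have a neighbour in the rows 1 to 38.\<close>

lemma tile_row_check: "\<forall>y\<in>set [-1..40]. tile_row_check y"
  by code_simp

lemma tile_row_less: "\<forall>y\<in>set [1..38]. tile_row y < 2 ^ 38 \<and> 0 \<le> tile_row y"
  by code_simp

lemma tile_rows_repeat: "\<forall>y\<in>set [10..13]. tile_row (y + 16) = tile_row y"
  by code_simp

text \<open>Bits 9 to 12 and 25 to 28 are the columns 10 to 13 and 26 to 29.\<close>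

lemma tile_columns_repeat:
  "\<forall>y\<in>set [1..38]. take_bit 4 (drop_bit 25 (tile_row y)) = take_bit 4 (drop_bit 9 (tile_row y))"
  by code_simp

lemma tile_block_count:
  "length (filter (\<lambda>(x, y). bit (tile_row y) (nat (x - 1))) (List.product [10..25] [10..25])) = 112"
  by code_simp

lemma tile_bounds:
  assumes "(x, y) \<in> tile"
  shows "1 \<le> x" "x \<le> 38" "1 \<le> y" "y \<le> 38"
proof -
  have bit: "bit (tile_row y) (nat (x - 1))" and x: "1 \<le> x"
    using assms by (auto simp: tile_def)
  have y: "1 \<le> y \<and> y \<le> 38"
    using bit by (auto simp: tile_row_def split: if_splits)
  have "take_bit 38 (tile_row y) = tile_row y"
    using tile_row_less y by (intro take_bit_int_eq_self) auto
  then have "nat (x - 1) < 38"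
    using bit by (metis bit_take_bit_iff)
  then show "1 \<le> x" "x \<le> 38" "1 \<le> y" "y \<le> 38"
    using x y by auto
qed

lemma tile_bit_iff:
  assumes "- 1 \<le> x" "\<bar>d\<bar> \<le> 2"
  shows "(x + d, z) \<in> tile \<longleftrightarrow> bit (push_bit (nat (2 - d)) (tile_row z)) (nat (x + 1))"
proof -
  have "nat (x + 1) - nat (2 - d) = nat (x + d - 1)"
    using assms by (simp add: nat_diff_distrib' algebra_simps flip: nat_diff_distrib)
  moreover have "nat (2 - d) \<le> nat (x + 1) \<longleftrightarrow> 1 \<le> x + d"
    using assms by auto
  ultimately show ?thesis
    by (simp add: tile_def bit_push_bit_iff)
qed

lemma odd_at_tile: "odd_at tile (x, y)"
proof (cases "- 1 \<le> y \<and> y \<le> 40 \<and> - 1 \<le> x")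
  case True
  then have "tile_row_check y"
    using tile_row_check by auto
  define j where "j = nat (x + 1)"
  define rs where "rs =
    [push_bit 1 (tile_row (y + 2)), push_bit 1 (tile_row (y - 2)),
     push_bit 3 (tile_row (y + 2)), push_bit 3 (tile_row (y - 2)),
     push_bit 0 (tile_row (y + 1)), push_bit 0 (tile_row (y - 1)),
     push_bit 4 (tile_row (y + 1)), push_bit 4 (tile_row (y - 1))]"
  have chk: "foldr xor rs 0 = foldr or rs 0" "and (foldr or rs 0) (push_bit 2 (tile_row y)) = 0"
    using \<open>tile_row_check y\<close> by (simp_all add: tile_row_check_def Let_def rs_def)
  have xor_bit: "bit (foldr xor ws 0) j \<longleftrightarrow> foldr (\<noteq>) (map (\<lambda>w. bit w j) ws) False"
    for ws :: "int list"
    by (induction ws) (auto simp: bit_xor_iff)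
  have or_bit: "bit (foldr or ws 0) j \<longleftrightarrow> True \<in> set (map (\<lambda>w. bit w j) ws)"
    for ws :: "int list"
    by (induction ws) (auto simp: bit_or_iff)
  have mem: "(x + d, z) \<in> tile \<longleftrightarrow> bit (push_bit (nat (2 - d)) (tile_row z)) j"
    if "\<bar>d\<bar> \<le> 2" for d z
    unfolding j_def using True that by (intro tile_bit_iff) auto
  have bits: "map (\<lambda>w. bit w j) rs = map (\<lambda>v. v \<in> tile)
     [(x + 1, y + 2), (x + 1, y - 2), (x - 1, y + 2), (x - 1, y - 2),
      (x + 2, y + 1), (x + 2, y - 1), (x - 2, y + 1), (x - 2, y - 1)]"
    using mem[of 1] mem[of "-1"] mem[of 2] mem[of "-2"] by (simp add: rs_def)
  have centre: "(x, y) \<in> tile \<longleftrightarrow> bit (push_bit 2 (tile_row y)) j"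
    using mem[of 0 y] by simp
  have "\<not> (bit (foldr or rs 0) j \<and> bit (push_bit 2 (tile_row y)) j)"
    using chk(2) by (metis bit_0_eq bit_and_iff bot_apply bot_bool_def)
  moreover have "bit (foldr xor rs 0) j \<longleftrightarrow> bit (foldr or rs 0) j"
    using chk(1) by simp
  ultimately show ?thesis
    unfolding odd_at_iff Let_def bits[symmetric] centre xor_bit or_bit by blast
next
  case False
  have "v \<notin> tile" if "v \<in> knight_nbrs (x, y)" for v
    using that tile_bounds[of "fst v" "snd v"] False by (auto simp: knight_nbrs_def)
  then show ?thesis
    by (auto simp: odd_at_def)
qed

section \<open>Stretching the pattern\<close>

text \<open>Two coordinates have the same phase if \<open>tile\<close> has equal rows, and equal columns, at these
  coordinates by its periodicity between the coordinates 10 and 29.\<close>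

definition same_phase :: "int \<Rightarrow> int \<Rightarrow> bool" where
  "same_phase u v \<longleftrightarrow>
     u = v \<or> u \<in> {10..29} \<and> v \<in> {10..29} \<and> u mod 16 = v mod 16"

lemma same_phase_cases:
  assumes "same_phase u v"
  obtains "u = v" | "u \<in> {10..13}" "v = u + 16" | "v \<in> {10..13}" "u = v + 16"
proof -
  have "u = v \<or> u \<in> {10..13} \<and> v = u + 16 \<or> v \<in> {10..13} \<and> u = v + 16"
  proof (cases "u = v")
    case False
    with assms have uv: "u \<in> {10..29}" "v \<in> {10..29}" "u mod 16 = v mod 16"
      by (auto simp: same_phase_def)
    then obtain q where "u - v = 16 * q"
      by (metis dvdE mod_eq_dvd_iff)
    moreover from this uv have "q \<in> {-1, 0, 1}"
      by auto
    ultimately show ?thesis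
      using uv by auto
  qed simp
  then show ?thesis
    using that by blast
qed

lemma tile_row_same_phase:
  assumes "same_phase y y'"
  shows "tile_row y = tile_row y'"
proof -
  have "tile_row (z + 16) = tile_row z" if "z \<in> {10..13}" for z
    using tile_rows_repeat that unfolding set_upto by blast
  with assms show ?thesis
    by (cases rule: same_phase_cases) auto
qed

lemma tile_same_phase_left:
  assumes "same_phase x x'"
  shows "(x, y) \<in> tile \<longleftrightarrow> (x', y) \<in> tile"
proof -
  have "(z + 16, y) \<in> tile \<longleftrightarrow> (z, y) \<in> tile" if z: "z \<in> {10..13}" for z
  proof (cases "y \<in> {1..38}")
    case True
    define i where "i = nat (z - 10)"
    have i: "i < 4" "nat (z - 1) = 9 + i" "nat (z + 16 - 1) = 25 + i"
      using z by (auto simp: i_def)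
    have "take_bit 4 (drop_bit 25 (tile_row y)) = take_bit 4 (drop_bit 9 (tile_row y))"
      using tile_columns_repeat True unfolding set_upto by blast
    then have "bit (take_bit 4 (drop_bit 25 (tile_row y))) i \<longleftrightarrow>
        bit (take_bit 4 (drop_bit 9 (tile_row y))) i"
      by simp
    then have "bit (tile_row y) (25 + i) \<longleftrightarrow> bit (tile_row y) (9 + i)"
      using i(1) by (simp add: bit_take_bit_iff bit_drop_bit_eq)
    then show ?thesis
      using z i(2,3) by (simp add: tile_def)
  next
    case False
    then show ?thesis
      using tile_bounds by auto
  qed
  with assms show ?thesis
    by (cases rule: same_phase_cases) auto
qed

lemma tile_same_phase:
  assumes "same_phase x x'" "same_phase y y'"
  shows "(x, y) \<in> tile \<longleftrightarrow> (x', y') \<in> tile"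
  using tile_same_phase_left[OF assms(1)] tile_row_same_phase[OF assms(2)]
  by (simp add: tile_def)

text \<open>The coordinate map that inserts \<open>k\<close> periods, namely copies of the coordinates 10 to 25,
  after coordinate 25.\<close>

definition stretch :: "nat \<Rightarrow> int \<Rightarrow> int" where
  "stretch k x =
     (if x < 26 then x
      else if x < 26 + 16 * int k then 10 + (x - 10) mod 16
      else x - 16 * int k)"

text \<open>Up to phase, five consecutive coordinates are mapped to five consecutive coordinates. Where
  five coordinates straddle two periods this uses that 26 to 29 have the phases of 10 to 13.\<close>

lemma stretch_window:
  obtains x' where "\<And>d. \<bar>d\<bar> \<le> 2 \<Longrightarrow> same_phase (stretch k (x + d)) (x' + d)"
proof -
  consider "x < 12" | "12 \<le> x" "x < 28 + 16 * int k" | "28 + 16 * int k \<le> x"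
    by linarith
  then show thesis
  proof cases
    case 1
    then have "same_phase (stretch k (x + d)) (x + d)" if "\<bar>d\<bar> \<le> 2" for d
      using that by (auto simp: stretch_def same_phase_def)
    then show thesis
      by (rule that)
  next
    case 2
    have "same_phase (stretch k (x + d)) (12 + (x - 12) mod 16 + d)" if "\<bar>d\<bar> \<le> 2" for d
    proof -
      have "stretch k z \<in> {10..29} \<and> stretch k z mod 16 = z mod 16"
        if "10 \<le> z" "z < 30 + 16 * int k" for z
      proof -
        have shift: "(z - 16 * int k) mod 16 = z mod 16"
          by (metis add.commute diff_add_cancel mod_mult_self2)
        have "(10 + (z - 10) mod 16) mod 16 = z mod 16"
          by (simp add: mod_simps)
        moreover have "0 \<le> (z - 10) mod 16" "(z - 10) mod 16 < 16"
          by simp_all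
        ultimately show ?thesis
          unfolding stretch_def using that shift by auto
      qed
      from this[of "x + d"] have "stretch k (x + d) \<in> {10..29}"
        "stretch k (x + d) mod 16 = (x + d) mod 16"
        using 2 \<open>\<bar>d\<bar> \<le> 2\<close> by auto
      moreover have "(12 + (x - 12) mod 16 + d) mod 16 = (x + d) mod 16"
      proof -
        have "12 + (x - 12) mod 16 + d = x + d + 16 * (- ((x - 12) div 16))"
          using div_mult_mod_eq[of "x - 12" 16] by linarith
        then show ?thesis
          by (simp only: mod_mult_self2)
      qed
      moreover have "0 \<le> (x - 12) mod 16" "(x - 12) mod 16 < 16"
        by simp_all
      ultimately show ?thesis
        using \<open>\<bar>d\<bar> \<le> 2\<close> by (auto simp: same_phase_def)
    qed
    then show thesis
      by (rule that)
  next
    case 3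
    then have "same_phase (stretch k (x + d)) (x - 16 * int k + d)" if "\<bar>d\<bar> \<le> 2" for d
      using that by (auto simp: stretch_def same_phase_def)
    then show thesis
      by (rule that)
  qed
qed

text \<open>The set \<open>tile\<close> with \<open>k\<close> periods inserted in each direction.\<close>

definition stretched_tile :: "nat \<Rightarrow> (int \<times> int) set" where
  "stretched_tile k = {(x, y). (stretch k x, stretch k y) \<in> tile}"

lemma odd_at_stretched_tile: "odd_at (stretched_tile k) v"
proof -
  obtain x y where v: "v = (x, y)"
    by force
  obtain x' where x': "\<And>d. \<bar>d\<bar> \<le> 2 \<Longrightarrow> same_phase (stretch k (x + d)) (x' + d)"
    by (rule stretch_window[of k x]) (rule that)
  obtain y' where y': "\<And>d. \<bar>d\<bar> \<le> 2 \<Longrightarrow> same_phase (stretch k (y + d)) (y' + d)"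
    by (rule stretch_window[of k y]) (rule that)
  have "odd_at (stretched_tile k) (x, y) \<longleftrightarrow> odd_at tile (x', y')"
    using tile_same_phase x' y' by (intro odd_at_cong) (simp add: stretched_tile_def)
  then show ?thesis
    by (simp add: v odd_at_tile)
qed

lemma stretch_bounds:
  assumes "1 \<le> stretch k x" "stretch k x \<le> 38"
  shows "1 \<le> x" "x \<le> 38 + 16 * int k"
  using assms by (auto simp: stretch_def split: if_splits)

lemma stretched_tile_subset:
  "stretched_tile k \<subseteq> {1..38 + 16 * int k} \<times> {1..38 + 16 * int k}"
proof
  fix v assume "v \<in> stretched_tile k"
  then obtain x y where "v = (x, y)" "(stretch k x, stretch k y) \<in> tile"
    by (auto simp: stretched_tile_def)
  with stretch_bounds[of k x] stretch_bounds[of k y] tile_bounds[of "stretch k x" "stretch k y"]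
  show "v \<in> {1..38 + 16 * int k} \<times> {1..38 + 16 * int k}"
    by simp
qed

text \<open>Only the \<open>k\<^sup>2\<close> inserted copies of the square \<open>{10..25} \<times> {10..25}\<close> are counted.\<close>

lemma card_stretched_tile: "112 * k\<^sup>2 \<le> card (stretched_tile k)"
proof -
  define B where "B = tile \<inter> {10..25} \<times> {10..25}"
  define g where "g = (\<lambda>((a, b), (u, v)). (u + 16 + 16 * int a, v + 16 + 16 * int b))"
  have "B = set (filter (\<lambda>(x, y). bit (tile_row y) (nat (x - 1)))
      (List.product [10..25] [10..25]))"
    unfolding B_def tile_def set_filter set_product set_upto by auto
  then have "card B = 112"
    using tile_block_count by (metis distinct_card distinct_filter distinct_product distinct_upto)
  then have "card (({..<k} \<times> {..<k}) \<times> B) = 112 * k\<^sup>2"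
    by (simp add: card_cartesian_product power2_eq_square)
  moreover have "inj_on g (({..<k} \<times> {..<k}) \<times> B)"
  proof -
    have "a = a' \<and> u = u'"
      if "u \<in> {10..25}" "u' \<in> {10..25}" "u + 16 + 16 * int a = u' + 16 + 16 * int a'"
      for u u' and a a' :: nat
    proof -
      have "a = a'"
        using that by auto
      with that show ?thesis
        by simp
    qed
    then show ?thesis
      by (auto simp: inj_on_def g_def B_def)
  qed
  moreover have "g ` (({..<k} \<times> {..<k}) \<times> B) \<subseteq> stretched_tile k"
  proof -
    have "stretch k (u + 16 + 16 * int a) = u" if "u \<in> {10..25}" "a < k" for u a
    proof -
      have "(u + 16 + 16 * int a - 10) mod 16 = u - 10"
      proof -
        have "u + 16 + 16 * int a - 10 = (u - 10) + 16 * (1 + int a)"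
          by simp
        also have "\<dots> mod 16 = (u - 10) mod 16"
          by (rule mod_mult_self2)
        also have "\<dots> = u - 10"
          using that by simp
        finally show ?thesis .
      qed
      then show ?thesis
        using that by (simp add: stretch_def)
    qed
    then show ?thesis
      by (auto simp: g_def B_def stretched_tile_def)
  qed
  moreover have "finite (stretched_tile k)"
    using stretched_tile_subset by (rule finite_subset) simp
  ultimately show ?thesis
    by (metis card_image card_mono)
qed

lemma odd_independence_number_lower:
  assumes "38 + 16 * k \<le> n"
  shows "112 * k\<^sup>2 \<le> odd_independence_number (knight_graph n)"
proof -
  have "stretched_tile k \<subseteq> pverts (knight_graph n)"
    using stretched_tile_subset[of k] assms by (fastforce simp: pverts_knight_graph)
  then have "odd_independent_set (knight_graph n) (stretched_tile k)"
    by (rule odd_independent_set_knight_graphI) (rule odd_at_stretched_tile)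
  then have "card (stretched_tile k) \<le> odd_independence_number (knight_graph n)"
    unfolding odd_independence_number_def
    using odd_independence_number_wf(1)[OF pair_graph_knight_graph] by (intro Max_ge) auto
  then show ?thesis
    using card_stretched_tile[of k] by linarith
qed

section \<open>The upper bound\<close>

text \<open>The edges between \<open>S\<close> and its complement are counted from both sides, using in \<open>S\<close> only the
  cells of the square \<open>J\<close>, where a knight has all its eight moves.\<close>

lemma card_odd_independent_set_knight_graph:
  assumes S: "odd_independent_set (knight_graph n) S"
  shows "15 * card S \<le> 7 * n\<^sup>2 + 64 * n"
proof -
  define V where "V = pverts (knight_graph n)"
  define J where "J = {3..int n - 2} \<times> {3..int n - 2}"
  have V: "V = {1..int n} \<times> {1..int n}"
    by (simp add: V_def pverts_knight_graph)
  have fin: "finite V" "finite J"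
    by (simp_all add: V J_def)
  have sub: "S \<subseteq> V"
    using S by (simp add: odd_independent_set_def independent_set_def V_def)
  have finS: "finite S"
    using sub fin by (blast intro: finite_subset)
  have eight: "card {v \<in> V - S. v \<in> knight_nbrs u} = 8" if "u \<in> S \<inter> J" for u
  proof -
    have "knight_nbrs u \<subseteq> V"
      using that by (cases u) (auto simp: knight_nbrs_def J_def V)
    moreover have "v \<notin> S" if "v \<in> knight_nbrs u" for v
      using S \<open>u \<in> S \<inter> J\<close> that sub
      unfolding odd_independent_set_def independent_set_def parcs_knight_graph V_def by blast
    ultimately have "{v \<in> V - S. v \<in> knight_nbrs u} = knight_nbrs u"
      by auto
    then show ?thesis
      by (simp add: card_knight_nbrs)
  qed
  have seven: "card {u \<in> S \<inter> J. v \<in> knight_nbrs u} \<le> 7" if "v \<in> V - S" for v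
  proof -
    have v: "v \<in> pverts (knight_graph n)"
      using that by (simp add: V_def)
    have "neighborhood (knight_graph n) v \<inter> S = knight_nbrs v \<inter> S"
      using neighborhood_knight_graph[OF v] sub by (auto simp: V_def)
    then have "knight_nbrs v \<inter> S = {} \<or> odd (card (knight_nbrs v \<inter> S))"
      using S that unfolding odd_independent_set_def V_def by metis
    moreover have "card (knight_nbrs v \<inter> S) \<le> 8"
      using card_mono[OF finite_knight_nbrs[of v], of "knight_nbrs v \<inter> S"]
      by (simp add: card_knight_nbrs)
    ultimately have "card (knight_nbrs v \<inter> S) \<le> 7"
      by (cases "card (knight_nbrs v \<inter> S) = 8") auto
    moreover have "{u \<in> S \<inter> J. v \<in> knight_nbrs u} \<subseteq> knight_nbrs v \<inter> S"
      using knight_nbrs_sym by blast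
    ultimately show ?thesis
      using card_mono[of "knight_nbrs v \<inter> S"] finite_knight_nbrs[of v]
      by (meson finite_Int le_trans)
  qed
  have "8 * card (S \<inter> J) = (\<Sum>u\<in>S \<inter> J. card {v \<in> V - S. v \<in> knight_nbrs u})"
    using eight by simp
  also have "\<dots> = (\<Sum>v\<in>V - S. card {u \<in> S \<inter> J. v \<in> knight_nbrs u})"
    using fin finS by (intro sum_multicount_gen) auto
  also have "\<dots> \<le> (\<Sum>v\<in>V - S. 7)"
    using seven by (rule sum_mono)
  also have "\<dots> = 7 * card (V - S)"
    by simp
  also have "\<dots> = 7 * n\<^sup>2 - 7 * card S"
    using sub finS by (simp add: card_Diff_subset V card_cartesian_product power2_eq_square
        diff_mult_distrib2)
  finally have main: "8 * card (S \<inter> J) \<le> 7 * n\<^sup>2 - 7 * card S" .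
  have "card S \<le> n\<^sup>2"
    using card_mono[OF fin(1) sub] by (simp add: V card_cartesian_product power2_eq_square)
  have "card S = card (S \<inter> J) + card (S - J)"
    using finS by (metis Diff_Diff_Int Int_commute card_Diff_subset_Int card_Int_Diff add.commute)
  also have "card (S - J) \<le> 8 * n"
  proof -
    have "card (S - J) \<le> card (V - J)"
      using sub fin by (intro card_mono) auto
    also have "\<dots> = card V - card J"
      using fin by (intro card_Diff_subset) (auto simp: V J_def)
    also have "\<dots> = n\<^sup>2 - (n - 4)\<^sup>2"
      by (simp add: V J_def card_cartesian_product power2_eq_square nat_diff_distrib')
    also have "\<dots> \<le> 8 * n"
    proof (cases "n < 4")
      case True
      then show ?thesis
        by (simp add: power2_eq_square)
    next
      case False
      then obtain m where "n = m + 4"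
        by (metis add.commute le_Suc_ex not_less)
      then show ?thesis
        by (simp add: power2_eq_square algebra_simps)
    qed
    finally show ?thesis .
  qed
  finally show ?thesis
    using main \<open>card S \<le> n\<^sup>2\<close> by linarith
qed

theorem proposition24:
  shows "\<exists>f g :: nat \<Rightarrow> real.
    f \<in> O(\<lambda>n. real n) \<and> g \<in> O(\<lambda>n. real n) \<and>
    (\<forall>n\<ge>1. 7 / 16 * (real n)\<^sup>2 - f n \<le> real (odd_independence_number (knight_graph n)) \<and>
            real (odd_independence_number (knight_graph n)) \<le> 7 / 15 * (real n)\<^sup>2 + g n)"
proof (intro exI conjI allI impI)
  show "(\<lambda>n. 47 * real n) \<in> O(\<lambda>n. real n)" "(\<lambda>n. 64 / 15 * real n) \<in> O(\<lambda>n. real n)"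
    by simp_all
next
  fix n :: nat
  show "7 / 16 * (real n)\<^sup>2 - 47 * real n \<le> real (odd_independence_number (knight_graph n))"
  proof (cases "n < 53")
    case True
    then have "7 / 16 * real n * real n \<le> 47 * real n"
      by (intro mult_right_mono) auto
    then have "7 / 16 * (real n)\<^sup>2 \<le> 47 * real n"
      by (simp add: power2_eq_square)
    then show ?thesis
      by linarith
  next
    case False
    define k where "k = (n - 38) div 16"
    \<comment> \<open>A side of \<open>38 + 16 k\<close> is the largest that fits, so \<open>16 k\<close> falls short of \<open>n\<close> by at most
      \<open>38 + 15\<close>.\<close>
    have k: "38 + 16 * k \<le> n" "n \<le> 16 * k + 53"
      using False by (auto simp: k_def)
    have "7 / 16 * (real n)\<^sup>2 - 47 * real n \<le> 7 / 16 * (real n - 53)\<^sup>2"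
      by (simp add: power2_eq_square algebra_simps)
    also have "\<dots> \<le> 7 / 16 * (16 * real k)\<^sup>2"
      using k False by (intro mult_left_mono power_mono) auto
    also have "\<dots> = real (112 * k\<^sup>2)"
      by (simp add: power2_eq_square)
    also have "\<dots> \<le> real (odd_independence_number (knight_graph n))"
      using odd_independence_number_lower[OF k(1)] by (intro of_nat_mono)
    finally show ?thesis .
  qed
next
  fix n :: nat
  have "odd_independence_number (knight_graph n)
      \<in> card ` {S. odd_independent_set (knight_graph n) S}"
    unfolding odd_independence_number_def
    using odd_independence_number_wf[OF pair_graph_knight_graph, of n] by (intro Max_in) auto
  then have "15 * odd_independence_number (knight_graph n) \<le> 7 * n\<^sup>2 + 64 * n"
    using card_odd_independent_set_knight_graph by auto
  then have "real (15 * odd_independence_number (knight_graph n)) \<le> real (7 * n\<^sup>2 + 64 * n)"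
    by (rule of_nat_mono)
  then show "real (odd_independence_number (knight_graph n)) \<le>
      7 / 15 * (real n)\<^sup>2 + 64 / 15 * real n"
    by simp
qed

end
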